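(* Let $k\ge1$ and let $p(x,y_1,\dots,y_k)\in\mathbb{C}[x,y_1,\dots,y_k]$ be an irreducible polynomial. Let $f(z)=p(z,e_1(z),\dots,e_k(z))$. Then $f$ has infinitely many zeros in $\mathbb{C}$ unless $p(x,y_1,\dots,y_k)=g(x)\,y_1^{n_1}\cdots y_k^{n_k}$ for some $g(x)\in\mathbb{C}[x]$ and $n_1,\dots,n_k\in\mathbb{N}$.
   Context: Define $e_0(z)=z$ and $e_{j+1}(z)=e^{e_j(z)}$ for $j\ge0$, so $e_1(z)=e^z$, $e_2(z)=e^{e^z}$, etc. *)

theory Defs
  imports Complex_Main "HOL-Library.Poly_Mapping"
begin

text \<open>
  A polynomial over the complex numbers in variables indexed by the natural numbers is an
  element of the monoid algebra \<open>(nat \<Rightarrow>\<^sub>0 nat) \<Rightarrow>\<^sub>0 complex\<close>: a monomial is a finitely supported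
  map from variables to exponents, a polynomial a finitely supported map from monomials to
  coefficients, and \<open>*\<close> is the convolution product.  Variable \<open>0\<close> plays the role of \<open>x\<close>
  and variable \<open>j\<close> that of \<open>y_j\<close> for \<open>j \<ge> 1\<close>.
\<close>

type_synonym cmpoly = "(nat \<Rightarrow>\<^sub>0 nat) \<Rightarrow>\<^sub>0 complex"

definition var :: "nat \<Rightarrow> cmpoly" where
  "var i = Poly_Mapping.single (Poly_Mapping.single i 1) 1"

definition polys_in :: "nat set \<Rightarrow> cmpoly set" where
  "polys_in V = {p. \<forall>m \<in> Poly_Mapping.keys p. Poly_Mapping.keys m \<subseteq> V}"

definition eval_cmpoly :: "(nat \<Rightarrow> complex) \<Rightarrow> cmpoly \<Rightarrow> complex" where
  "eval_cmpoly a p =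
     (\<Sum>m \<in> Poly_Mapping.keys p. Poly_Mapping.lookup p m *
        (\<Prod>i \<in> Poly_Mapping.keys m. a i ^ Poly_Mapping.lookup m i))"

definition unit_in :: "nat set \<Rightarrow> cmpoly \<Rightarrow> bool" where
  "unit_in V p \<longleftrightarrow> p \<in> polys_in V \<and> (\<exists>q \<in> polys_in V. p * q = 1)"

text \<open>
  Irreducibility as an element of the ring \<open>polys_in V\<close>: the clauses of the library predicate \<open>irreducible\<close>,
  with units and factors taken in that subring instead of in the ring in all variables.
\<close>

definition irreducible_in :: "nat set \<Rightarrow> cmpoly \<Rightarrow> bool" where
  "irreducible_in V p \<longleftrightarrow> p \<in> polys_in V \<and> p \<noteq> 0 \<and> \<not> unit_in V p \<and>
     (\<forall>a \<in> polys_in V. \<forall>b \<in> polys_in V. p = a * b \<longrightarrow> unit_in V a \<or> unit_in V b)"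

primrec iter_exp :: "nat \<Rightarrow> complex \<Rightarrow> complex" where
  "iter_exp 0 z = z"
| "iter_exp (Suc j) z = exp (iter_exp j z)"

end

theory Submission
  imports Defs
    "HOL-Complex_Analysis.Complex_Analysis"
    "HOL-Computational_Algebra.Fundamental_Theorem_Algebra"
    "HOL-Real_Asymp.Real_Asymp"
begin

text \<open>
  Let \<open>y\<^sub>K\<close> be the last variable whose exponent is not the same in all monomials of \<open>p\<close>; the later
  exponentials only contribute a zero-free factor.  Substituting \<open>u = e\<^sub>K\<^sub>-\<^sub>1(z)\<close>, that is
  \<open>z = Ln (\<dots> (Ln u))\<close>, turns \<open>f\<close> into an exponential sum \<open>\<Sum>\<^sub>n b\<^sub>n(u) e\<^sup>n\<^sup>u\<close> with at least two terms, where
  each \<open>b\<^sub>n\<close> is a polynomial in \<open>u\<close> and its iterated logarithms.  Such a \<open>b\<^sub>n\<close> is asymptotic to its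
  dominant monomial, hence grows at most polynomially and is slowly varying:
  \<open>b\<^sub>n(u + v) / b\<^sub>n(u) \<rightarrow> 1\<close> for bounded \<open>v\<close>.  On the line \<open>Im u = 2 \<pi> m\<close>, \<open>m\<close> large, the intermediate value theorem gives a
  point \<open>U\<^sub>m\<close> at which \<open>\<bar>b\<^sub>0\<bar>\<close> balances the sum of the moduli of the other terms.  Divided by
  \<open>b\<^sub>0(U\<^sub>m)\<close> and translated by \<open>U\<^sub>m\<close>, the sums converge along a subsequence to a non-monomial
  polynomial in \<open>e\<^sup>v\<close>, which has a zero, and Hurwitz's theorem carries this zero back.
\<close>

section \<open>Growth of monomials in iterated logarithms\<close>

text \<open>The value is \<open>u ^ a\<^sub>0 * Ln u ^ a\<^sub>1 * Ln (Ln u) ^ a\<^sub>2 *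
  ...\<close>. Recursing through \<open>Ln u\<close> allows induction on the list, with the
  induction hypothesis composed with \<open>Ln\<close>.\<close>

primrec log_monomial :: "nat list \<Rightarrow> complex \<Rightarrow> complex" where
  "log_monomial [] u = 1"
| "log_monomial (a # as) u = u ^ a * log_monomial as (Ln u)"

text \<open>The real part \<open>ln (norm u)\<close> alone tends to infinity. This is what allows
  statements about all large \<open>u\<close> to be applied at \<open>Ln u\<close>.\<close>

lemma filterlim_Ln_at_infinity: "filterlim Ln at_infinity at_infinity"
proof -
  have "filterlim (\<lambda>u::complex. ln (norm u)) at_top at_infinity"
    by (rule filterlim_compose[OF ln_at_top filterlim_norm_at_top])
  moreover have "\<forall>\<^sub>F u in at_infinity. ln (norm u) \<le> norm (Ln u)"
    using eventually_not_equal_at_infinity[of "0::complex"]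
    by eventually_elim (metis Re_Ln complex_Re_le_cmod)
  ultimately have "filterlim (\<lambda>u::complex. norm (Ln u)) at_top at_infinity"
    by (rule filterlim_at_top_mono)
  then show ?thesis
    by (simp add: filterlim_at_infinity_conv_norm_at_top)
qed

lemma eventually_norm_gt_at_infinity: "\<forall>\<^sub>F u::complex in at_infinity. r < norm u"
  using filterlim_norm_at_top[where 'a=complex] by (simp add: filterlim_at_top_dense)

lemma norm_Ln_le_ln:
  assumes "norm u > 1"
  shows "norm (Ln u) \<le> ln (norm u) + pi"
proof -
  have "u \<noteq> 0" and "ln (norm u) > 0" using assms ln_gt_zero[OF assms] by auto
  then show ?thesis
    using cmod_le[of "Ln u"] mpi_less_Im_Ln[of u] Im_Ln_le_pi[of u] by simp
qed

text \<open>The imaginary part of the principal branch is bounded by \<open>pi\<close>, which leaves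
  the real limit of \<open>(ln x + pi) ^ n / x\<close>.\<close>

lemma tendsto_Ln_power_div: "((\<lambda>u. Ln u ^ n / u) \<longlongrightarrow> 0) at_infinity"
proof (rule tendsto_norm_zero_cancel, rule tendsto_sandwich[OF _ _ tendsto_const])
  have "((\<lambda>x::real. (ln x + pi) ^ n / x) \<longlongrightarrow> 0) at_top"
    by real_asymp
  from filterlim_compose[OF this filterlim_norm_at_top]
  show "((\<lambda>u::complex. (ln (norm u) + pi) ^ n / norm u) \<longlongrightarrow> 0) at_infinity" .
  show "\<forall>\<^sub>F u in at_infinity. norm (Ln u ^ n / u) \<le> (ln (norm u) + pi) ^ n / norm u"
    using eventually_norm_gt_at_infinity[of 1]
    by eventually_elim
      (auto simp: norm_divide norm_power intro!: divide_right_mono power_mono norm_Ln_le_ln)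
qed auto

lemma eventually_norm_Ln_le: "\<forall>\<^sub>F u in at_infinity. norm (Ln u) \<le> norm u"
proof -
  have "\<forall>\<^sub>F u in at_infinity. norm (Ln u ^ 1 / u) < 1"
    using tendsto_Ln_power_div[of 1] by (auto dest!: tendstoD[where e=1] simp: dist_norm)
  then show ?thesis
    using eventually_not_equal_at_infinity[of "0::complex"]
    by eventually_elim (auto simp: norm_divide divide_simps)
qed

lemma eventually_norm_log_monomial_ge_1: "\<forall>\<^sub>F u in at_infinity. 1 \<le> norm (log_monomial as u)"
proof (induction as)
  case (Cons a as)
  have "\<forall>\<^sub>F u in at_infinity. 1 \<le> norm (log_monomial as (Ln u))"
    by (rule eventually_compose_filterlim[OF Cons filterlim_Ln_at_infinity])
  with eventually_norm_gt_at_infinity[of 1] show ?case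
  proof eventually_elim
    case (elim u)
    then have "1 * 1 \<le> norm u ^ a * norm (log_monomial as (Ln u))"
      by (intro mult_mono one_le_power) auto
    then show ?case by (simp add: norm_mult norm_power)
  qed
qed simp

lemma eventually_norm_log_monomial_le:
  "\<forall>\<^sub>F u in at_infinity. norm (log_monomial as u) \<le> norm u ^ sum_list as"
proof (induction as)
  case (Cons a as)
  have "\<forall>\<^sub>F u in at_infinity. norm (log_monomial as (Ln u)) \<le> norm (Ln u) ^ sum_list as"
    by (rule eventually_compose_filterlim[OF Cons filterlim_Ln_at_infinity])
  with eventually_norm_Ln_le show ?case
  proof eventually_elim
    case (elim u)
    then have "norm (log_monomial as (Ln u)) \<le> norm u ^ sum_list as"
      by (meson norm_ge_zero order_trans power_mono)
    then show ?case
      by (simp add: norm_mult norm_power power_add mult_left_mono)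
  qed
qed simp

text \<open>A monomial starting at \<open>Ln u\<close> is bounded by a power of \<open>Ln u\<close>,
  and a single factor \<open>u\<close> beats every such power.\<close>

lemma tendsto_log_monomial_Ln_div:
  "((\<lambda>u. log_monomial as (Ln u) / u) \<longlongrightarrow> 0) at_infinity"
proof (rule Lim_null_comparison)
  show "((\<lambda>u. norm (Ln u ^ sum_list as / u)) \<longlongrightarrow> 0) at_infinity"
    using tendsto_Ln_power_div tendsto_norm_zero by blast
  show "\<forall>\<^sub>F u in at_infinity. norm (log_monomial as (Ln u) / u) \<le> norm (Ln u ^ sum_list as / u)"
    using eventually_compose_filterlim[OF eventually_norm_log_monomial_le[of as] filterlim_Ln_at_infinity]
    by eventually_elim (auto simp: norm_divide norm_power intro!: divide_right_mono)
qed

section \<open>The lexicographic order of growth\<close>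

text \<open>The surplus factor \<open>u\<close> in the denominator outweighs all logarithms in the
  numerator; the logarithmic part of the denominator eventually has modulus at least 1.\<close>

lemma log_monomial_div_tendsto_0:
  assumes "a < b"
  shows "((\<lambda>u. log_monomial (a # as) u / log_monomial (b # bs) u) \<longlongrightarrow> 0) at_infinity"
proof (rule Lim_null_comparison)
  show "((\<lambda>u. norm (log_monomial as (Ln u) / u)) \<longlongrightarrow> 0) at_infinity"
    using tendsto_log_monomial_Ln_div tendsto_norm_zero by blast
  show "\<forall>\<^sub>F u in at_infinity. norm (log_monomial (a # as) u / log_monomial (b # bs) u)
      \<le> norm (log_monomial as (Ln u) / u)"
    using eventually_compose_filterlim[OF eventually_norm_log_monomial_ge_1[of bs] filterlim_Ln_at_infinity]
      eventually_norm_gt_at_infinity[of 1]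
  proof eventually_elim
    case (elim u)
    have "norm u ^ a * norm u \<le> norm u ^ b"
      using assms elim(2) power_increasing[of "Suc a" b "norm u"] by (simp add: mult.commute)
    also have "\<dots> \<le> norm u ^ b * norm (log_monomial bs (Ln u))"
      using elim mult_left_mono[of 1 "norm (log_monomial bs (Ln u))" "norm u ^ b"] by simp
    finally have "norm u ^ a / (norm u ^ b * norm (log_monomial bs (Ln u))) \<le> 1 / norm u"
      using elim by (auto simp: divide_simps zero_less_mult_iff)
    from mult_right_mono[OF this, of "norm (log_monomial as (Ln u))"]
    show ?case by (simp add: norm_mult norm_divide norm_power)
  qed
qed

text \<open>Growth follows the lexicographic order of the exponent lists: equal leading exponents
  cancel and leave a ratio of shorter monomials at \<open>Ln u\<close>, and the first difference
  decides.\<close>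

lemma log_monomial_dichotomy:
  assumes "length as = length bs" and "as \<noteq> bs"
  shows "((\<lambda>u. log_monomial as u / log_monomial bs u) \<longlongrightarrow> 0) at_infinity \<or>
         ((\<lambda>u. log_monomial bs u / log_monomial as u) \<longlongrightarrow> 0) at_infinity"
  using assms
proof (induction as bs rule: list_induct2)
  case (Cons a as b bs)
  show ?case
  proof (cases a b rule: linorder_cases)
    case equal
    have *: "((\<lambda>u. log_monomial (b # as) u / log_monomial (b # bs) u) \<longlongrightarrow> 0) at_infinity"
      if "((\<lambda>u. log_monomial as u / log_monomial bs u) \<longlongrightarrow> 0) at_infinity" for as bs
    proof (rule Lim_transform_eventually)
      show "((\<lambda>u. log_monomial as (Ln u) / log_monomial bs (Ln u)) \<longlongrightarrow> 0) at_infinity"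
        by (rule filterlim_compose[OF that filterlim_Ln_at_infinity])
      show "\<forall>\<^sub>F u in at_infinity. log_monomial as (Ln u) / log_monomial bs (Ln u) =
          log_monomial (b # as) u / log_monomial (b # bs) u"
        using eventually_not_equal_at_infinity[of "0::complex"] by eventually_elim simp
    qed
    show ?thesis using Cons equal *[of as bs] *[of bs as] by auto
  qed (use log_monomial_div_tendsto_0 in blast)+
qed simp

text \<open>Being negligible is transitive, because ratios multiply; so comparing each new monomial
  with the current dominant one suffices.\<close>

lemma dominant_log_monomial:
  assumes "finite A" "A \<noteq> {}" and len: "\<And>as. as \<in> A \<Longrightarrow> length as = n"
  shows "\<exists>as\<in>A. \<forall>bs\<in>A - {as}. ((\<lambda>u. log_monomial bs u / log_monomial as u) \<longlongrightarrow> 0) at_infinity"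
  using assms
proof (induction A rule: finite_ne_induct)
  case (insert bs A)
  then obtain as where as: "as \<in> A"
    and dom: "\<And>cs. cs \<in> A - {as} \<Longrightarrow> ((\<lambda>u. log_monomial cs u / log_monomial as u) \<longlongrightarrow> 0) at_infinity"
    by auto
  have "bs \<noteq> as" "length bs = length as" using as insert by auto
  from log_monomial_dichotomy[OF this(2,1)] show ?case
  proof
    assume "((\<lambda>u. log_monomial bs u / log_monomial as u) \<longlongrightarrow> 0) at_infinity"
    then show ?thesis using as dom by auto
  next
    assume lim: "((\<lambda>u. log_monomial as u / log_monomial bs u) \<longlongrightarrow> 0) at_infinity"
    have "((\<lambda>u. log_monomial cs u / log_monomial bs u) \<longlongrightarrow> 0) at_infinity" if "cs \<in> A" for cs
    proof (cases "cs = as")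
      case False
      then have "((\<lambda>u. (log_monomial cs u / log_monomial as u) * (log_monomial as u / log_monomial bs u))
          \<longlongrightarrow> 0 * 0) at_infinity"
        using that dom lim by (intro tendsto_mult) auto
      then have "((\<lambda>u. (log_monomial cs u / log_monomial as u) * (log_monomial as u / log_monomial bs u))
          \<longlongrightarrow> 0) at_infinity" by simp
      moreover have "\<forall>\<^sub>F u in at_infinity.
          (log_monomial cs u / log_monomial as u) * (log_monomial as u / log_monomial bs u) =
          log_monomial cs u / log_monomial bs u"
        using eventually_norm_log_monomial_ge_1[of as] by eventually_elim auto
      ultimately show ?thesis by (rule Lim_transform_eventually)
    qed (use lim in simp)
    then show ?thesis by auto
  qed
qed auto

section \<open>Functions asymptotic to a logarithmic monomial\<close>

text \<open>This isolates the asymptotic behaviour required of the coefficients of the exponential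
  sum. The nonzero limit \<open>c\<close> yields lower bounds and quotients as well as upper
  bounds.\<close>

definition log_asymp :: "(complex \<Rightarrow> complex) \<Rightarrow> bool" where
  "log_asymp b \<longleftrightarrow>
     (\<exists>as c. c \<noteq> 0 \<and> ((\<lambda>u. b u / log_monomial as u) \<longlongrightarrow> c) at_infinity)"

text \<open>Division by the dominant monomial sends every other term to 0 and leaves its coefficient
  as the limit. Injectivity of \<open>e\<close> ensures that no two terms share a monomial and
  cancel.\<close>

lemma log_asymp_sum:
  assumes "finite S" "S \<noteq> {}" and c: "\<And>s. s \<in> S \<Longrightarrow> c s \<noteq> 0"
    and len: "\<And>s. s \<in> S \<Longrightarrow> length (e s) = n" and inj: "inj_on e S"
  shows "log_asymp (\<lambda>u. \<Sum>s\<in>S. c s * log_monomial (e s) u)"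
proof -
  obtain t where t: "t \<in> S"
    and dom: "\<And>s. s \<in> S - {t} \<Longrightarrow>
      ((\<lambda>u. log_monomial (e s) u / log_monomial (e t) u) \<longlongrightarrow> 0) at_infinity"
  proof -
    obtain t where t: "t \<in> S" and *: "\<forall>bs\<in>e ` S - {e t}.
        ((\<lambda>u. log_monomial bs u / log_monomial (e t) u) \<longlongrightarrow> 0) at_infinity"
      using dominant_log_monomial[of "e ` S" n] assms(1,2) len by blast
    have "e s \<in> e ` S - {e t}" if "s \<in> S - {t}" for s
      using that t inj by (auto dest: inj_onD)
    with * t that show thesis by blast
  qed
  have "((\<lambda>u. log_monomial (e s) u / log_monomial (e t) u) \<longlongrightarrow> (if s = t then 1 else 0)) at_infinity"
    if "s \<in> S" for s
  proof (cases "s = t")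
    case True
    have "\<forall>\<^sub>F u in at_infinity. 1 = log_monomial (e t) u / log_monomial (e t) u"
      using eventually_norm_log_monomial_ge_1[of "e t"] by eventually_elim auto
    from Lim_transform_eventually[OF tendsto_const this] show ?thesis using True by simp
  qed (use that dom in auto)
  then have "((\<lambda>u. \<Sum>s\<in>S. c s * (log_monomial (e s) u / log_monomial (e t) u)) \<longlongrightarrow>
      (\<Sum>s\<in>S. c s * (if s = t then 1 else 0))) at_infinity"
    by (intro tendsto_sum tendsto_mult tendsto_const)
  then have "((\<lambda>u. (\<Sum>s\<in>S. c s * log_monomial (e s) u) / log_monomial (e t) u) \<longlongrightarrow> c t) at_infinity"
    using t \<open>finite S\<close> by (simp add: sum_divide_distrib if_distrib cong: if_cong)
  then show ?thesis unfolding log_asymp_def using c[OF t] by blast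
qed

section \<open>Slow variation\<close>

text \<open>
  No branch condition is needed here: crossing the cut changes \<open>Ln\<close> by \<open>2 \<pi> \<i>\<close>, which is
  negligible against \<open>Ln (U x)\<close>.
\<close>

lemma tendsto_Ln_ratio:
  assumes U: "filterlim U at_infinity F" and r: "((\<lambda>x. V x / U x) \<longlongrightarrow> 1) F"
  shows "((\<lambda>x. Ln (V x) / Ln (U x)) \<longlongrightarrow> 1) F"
proof -
  have LnU: "filterlim (\<lambda>x. Ln (U x)) at_infinity F"
    by (rule filterlim_compose[OF filterlim_Ln_at_infinity U])
  have "((\<lambda>x. norm (V x / U x)) \<longlongrightarrow> norm (1::complex)) F"
    by (rule tendsto_norm[OF r])
  then have "((\<lambda>x. ln (norm (V x / U x))) \<longlongrightarrow> ln 1) F"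
    by (intro tendsto_ln) auto
  then have "((\<lambda>x. \<bar>ln (norm (V x / U x))\<bar>) \<longlongrightarrow> 0) F"
    by (simp add: tendsto_rabs_zero)
  then have evln: "\<forall>\<^sub>F x in F. \<bar>ln (norm (V x / U x))\<bar> < 1"
    by (rule order_tendstoD) simp
  have evV: "\<forall>\<^sub>F x in F. V x / U x \<noteq> 0"
    using tendsto_imp_eventually_ne[OF r, of 0] by simp
  have "((\<lambda>x. (Ln (V x) - Ln (U x)) / Ln (U x)) \<longlongrightarrow> 0) F"
  proof (rule Lim_null_comparison)
    show "((\<lambda>x. norm (of_real (1 + 2 * pi) / Ln (U x))) \<longlongrightarrow> 0) F"
      using tendsto_divide_0[OF tendsto_const LnU] tendsto_norm_zero by blast
    show "\<forall>\<^sub>F x in F. norm ((Ln (V x) - Ln (U x)) / Ln (U x)) \<le> norm (of_real (1 + 2 * pi) / Ln (U x))"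
      using evln evV
    proof eventually_elim
      case (elim x)
      then have nz: "V x \<noteq> 0" "U x \<noteq> 0" by auto
      have "\<bar>Re (Ln (V x) - Ln (U x))\<bar> \<le> 1"
        using elim nz by (simp add: norm_divide ln_div)
      moreover have "\<bar>Im (Ln (V x) - Ln (U x))\<bar> \<le> 2 * pi"
        using mpi_less_Im_Ln[OF nz(1)] mpi_less_Im_Ln[OF nz(2)]
          Im_Ln_le_pi[OF nz(1)] Im_Ln_le_pi[OF nz(2)] by simp
      ultimately have "norm (Ln (V x) - Ln (U x)) \<le> 1 + 2 * pi"
        using cmod_le[of "Ln (V x) - Ln (U x)"] by linarith
      then show ?case
        using pi_gt_zero unfolding norm_divide norm_of_real by (simp add: divide_right_mono)
    qed
  qed
  then have "((\<lambda>x. (Ln (V x) - Ln (U x)) / Ln (U x) + 1) \<longlongrightarrow> 0 + 1) F"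
    by (intro tendsto_intros)
  moreover have "\<forall>\<^sub>F x in F. (Ln (V x) - Ln (U x)) / Ln (U x) + 1 = Ln (V x) / Ln (U x)"
    using filterlim_at_infinity_imp_eventually_ne[OF LnU, of 0]
    by eventually_elim (simp add: field_simps)
  ultimately show ?thesis
    using Lim_transform_eventually by force
qed

lemma filterlim_at_infinity_ratio:
  fixes U V :: "'a \<Rightarrow> complex"
  assumes U: "filterlim U at_infinity F" and r: "((\<lambda>x. V x / U x) \<longlongrightarrow> 1) F"
  shows "filterlim V at_infinity F"
proof -
  have "filterlim (\<lambda>x. V x / U x * U x) at_infinity F"
    by (rule tendsto_mult_filterlim_at_infinity[OF r _ U]) simp
  moreover have "\<forall>\<^sub>F x in F. V x / U x * U x = V x"
    using filterlim_at_infinity_imp_eventually_ne[OF U, of 0] by eventually_elim simp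
  ultimately show ?thesis
    using filterlim_cong by force
qed

text \<open>The hypotheses on \<open>U\<close> and \<open>V\<close> are inherited by their
  logarithms, so the induction peels off one factor at a time with \<open>U\<close> and
  \<open>V\<close> arbitrary.\<close>

lemma tendsto_log_monomial_ratio:
  assumes "filterlim U at_infinity F" and "((\<lambda>x. V x / U x) \<longlongrightarrow> 1) F"
  shows "((\<lambda>x. log_monomial as (V x) / log_monomial as (U x)) \<longlongrightarrow> 1) F"
  using assms
proof (induction as arbitrary: U V)
  case (Cons a as)
  have "((\<lambda>x. log_monomial as (Ln (V x)) / log_monomial as (Ln (U x))) \<longlongrightarrow> 1) F"
    using Cons.prems
    by (intro Cons.IH tendsto_Ln_ratio filterlim_compose[OF filterlim_Ln_at_infinity])
  from tendsto_mult[OF tendsto_power[OF Cons.prems(2), of a] this]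
  show ?case by (simp add: power_divide)
qed simp

text \<open>Splitting \<open>b\<close> into \<open>b\<close> over its monomial times that monomial,
  the first quotient tends to \<open>c / c\<close> and the second to 1.\<close>

lemma log_asymp_ratio:
  assumes "log_asymp b" and U: "filterlim U at_infinity F" and r: "((\<lambda>x. V x / U x) \<longlongrightarrow> 1) F"
  shows "((\<lambda>x. b (V x) / b (U x)) \<longlongrightarrow> 1) F"
proof -
  obtain as c where c: "c \<noteq> 0" and lim: "((\<lambda>u. b u / log_monomial as u) \<longlongrightarrow> c) at_infinity"
    using assms(1) unfolding log_asymp_def by blast
  have V: "filterlim V at_infinity F" by (rule filterlim_at_infinity_ratio[OF U r])
  have "((\<lambda>x. (b (V x) / log_monomial as (V x)) / (b (U x) / log_monomial as (U x)) *
      (log_monomial as (V x) / log_monomial as (U x))) \<longlongrightarrow> c / c * 1) F"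
    by (intro tendsto_mult tendsto_divide c tendsto_log_monomial_ratio U r
        filterlim_compose[OF lim U] filterlim_compose[OF lim V])
  then have "((\<lambda>x. (b (V x) / log_monomial as (V x)) / (b (U x) / log_monomial as (U x)) *
      (log_monomial as (V x) / log_monomial as (U x))) \<longlongrightarrow> 1) F"
    using c by simp
  moreover have "\<forall>\<^sub>F x in F. (b (V x) / log_monomial as (V x)) / (b (U x) / log_monomial as (U x)) *
      (log_monomial as (V x) / log_monomial as (U x)) = b (V x) / b (U x)"
    using eventually_compose_filterlim[OF eventually_norm_log_monomial_ge_1[of as] U]
      eventually_compose_filterlim[OF eventually_norm_log_monomial_ge_1[of as] V]
    by eventually_elim (auto simp: field_simps)
  ultimately show ?thesis by (rule Lim_transform_eventually)
qed

section \<open>Growth bounds, differentiability and uniformity\<close>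

lemma log_asymp_lower:
  assumes "log_asymp b"
  obtains c where "c > 0" "\<forall>\<^sub>F u in at_infinity. c \<le> norm (b u)"
proof -
  obtain as c where c: "c \<noteq> 0" and lim: "((\<lambda>u. b u / log_monomial as u) \<longlongrightarrow> c) at_infinity"
    using assms unfolding log_asymp_def by blast
  have "\<forall>\<^sub>F u in at_infinity. norm c / 2 < norm (b u / log_monomial as u)"
    by (rule order_tendstoD[OF tendsto_norm[OF lim]]) (use c in auto)
  then have "\<forall>\<^sub>F u in at_infinity. norm c / 2 \<le> norm (b u)"
    using eventually_norm_log_monomial_ge_1[of as]
  proof eventually_elim
    case (elim u)
    have "norm (b u / log_monomial as u) \<le> norm (b u)"
      unfolding norm_divide using elim(2) by (simp add: divide_simps mult_le_cancel_left1)
    with elim show ?case by linarith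
  qed
  then show ?thesis using that[of "norm c / 2"] c by simp
qed

text \<open>The dominant monomial is bounded by a power of \<open>norm u\<close>, which every
  exponential decay beats.\<close>

lemma log_asymp_upper:
  assumes "log_asymp b" "\<epsilon> > 0"
  shows "((\<lambda>u. norm (b u) * exp (- \<epsilon> * norm u)) \<longlongrightarrow> 0) at_infinity"
proof -
  obtain as c where lim: "((\<lambda>u. b u / log_monomial as u) \<longlongrightarrow> c) at_infinity"
    using assms unfolding log_asymp_def by blast
  have "((\<lambda>x. x ^ sum_list as * exp (- \<epsilon> * x)) \<longlongrightarrow> 0) at_top"
    using assms(2) by real_asymp
  from filterlim_compose[OF this filterlim_norm_at_top]
  have "((\<lambda>u::complex. norm u ^ sum_list as * exp (- \<epsilon> * norm u)) \<longlongrightarrow> 0) at_infinity" .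
  from tendsto_mult[OF tendsto_norm[OF lim] this]
  have "((\<lambda>u. norm (b u / log_monomial as u) * (norm u ^ sum_list as * exp (- \<epsilon> * norm u))) \<longlongrightarrow> 0) at_infinity"
    by simp
  then show ?thesis
  proof (rule Lim_null_comparison[rotated])
    show "\<forall>\<^sub>F u in at_infinity. norm (norm (b u) * exp (- \<epsilon> * norm u)) \<le>
        norm (b u / log_monomial as u) * (norm u ^ sum_list as * exp (- \<epsilon> * norm u))"
      using eventually_norm_log_monomial_le[of as] eventually_norm_log_monomial_ge_1[of as]
    proof eventually_elim
      case (elim u)
      have "norm (b u) = norm (b u / log_monomial as u) * norm (log_monomial as u)"
        using elim by (auto simp: norm_divide)
      also have "\<dots> \<le> norm (b u / log_monomial as u) * norm u ^ sum_list as"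
        using elim by (intro mult_left_mono) auto
      finally show ?case
        by (simp add: mult.assoc[symmetric] mult_right_mono)
    qed
  qed
qed

text \<open>For \<open>norm u > 1\<close> the real part of \<open>Ln u\<close> is positive, so
  \<open>Ln u\<close> is off the cut and the induction hypothesis applies there. Only the cut of the
  outermost \<open>Ln\<close> has to be excluded.\<close>

lemma eventually_log_monomial_differentiable:
  "\<forall>\<^sub>F u in at_infinity. u \<notin> \<real>\<^sub>\<le>\<^sub>0 \<longrightarrow> log_monomial as field_differentiable at u"
proof (induction as)
  case (Cons a as)
  have "\<forall>\<^sub>F u in at_infinity. Ln u \<notin> \<real>\<^sub>\<le>\<^sub>0 \<longrightarrow> log_monomial as field_differentiable at (Ln u)"
    by (rule eventually_compose_filterlim[OF Cons filterlim_Ln_at_infinity])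
  with eventually_norm_gt_at_infinity[of 1] show ?case
  proof eventually_elim
    case (elim u)
    show ?case
    proof
    assume u: "u \<notin> \<real>\<^sub>\<le>\<^sub>0"
    have "u \<noteq> 0" using u by auto
    then have "Re (Ln u) > 0" using elim(1) ln_gt_zero by simp
    then have "Ln u \<notin> \<real>\<^sub>\<le>\<^sub>0" by (auto simp: complex_nonpos_Reals_iff)
    with elim(2) have "log_monomial as field_differentiable at (Ln u)" by simp
    moreover have "Ln field_differentiable at u"
      using u by (simp add: field_differentiable_at_Ln)
    ultimately have "(log_monomial as \<circ> Ln) field_differentiable at u"
      by (intro field_differentiable_compose)
    then have "(\<lambda>u. u ^ a * (log_monomial as \<circ> Ln) u) field_differentiable at u"
      by (intro field_differentiable_mult field_differentiable_power field_differentiable_ident)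
    moreover have "log_monomial (a # as) = (\<lambda>u. u ^ a * (log_monomial as \<circ> Ln) u)"
      by (simp add: fun_eq_iff)
    ultimately show "log_monomial (a # as) field_differentiable at u" by simp
    qed
  qed
qed simp

text \<open>Convergence along the product of \<open>sequentially\<close> with
  \<open>principal K\<close> is uniform convergence on \<open>K\<close>. As \<open>v\<close> is
  bounded, \<open>(U m + v) / U m\<close> tends to 1 along this filter, so
  \<open>log_asymp_ratio\<close> gives the uniform statement directly.\<close>

lemma log_asymp_uniform_ratio:
  assumes "log_asymp b" and U: "filterlim U at_infinity sequentially" and K: "bounded K"
  shows "uniform_limit K (\<lambda>m v. b (U m + v) / b (U m)) (\<lambda>_. 1) sequentially"
proof -
  let ?F = "sequentially \<times>\<^sub>F principal K"
  obtain B where B: "\<And>v. v \<in> K \<Longrightarrow> norm v \<le> B" using K bounded_iff by blast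
  have U': "filterlim (\<lambda>x. U (fst x)) at_infinity ?F"
    by (rule filterlim_compose[OF U filterlim_fst])
  have inK: "\<forall>\<^sub>F x in ?F. snd x \<in> K"
    using filterlim_snd[of "principal K" sequentially] by (simp add: filterlim_principal)
  have "((\<lambda>x. snd x / U (fst x)) \<longlongrightarrow> 0) ?F"
  proof (rule Lim_null_comparison)
    show "((\<lambda>x. norm (of_real B / U (fst x))) \<longlongrightarrow> 0) ?F"
      using tendsto_divide_0[OF tendsto_const U'] tendsto_norm_zero by blast
    show "\<forall>\<^sub>F x in ?F. norm (snd x / U (fst x)) \<le> norm (of_real B / U (fst x))"
      using inK by eventually_elim
        (use B in \<open>force simp: norm_divide intro!: divide_right_mono intro: order_trans\<close>)
  qed
  then have "((\<lambda>x. 1 + snd x / U (fst x)) \<longlongrightarrow> 1 + 0) ?F"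
    by (intro tendsto_intros)
  then have "((\<lambda>x. 1 + snd x / U (fst x)) \<longlongrightarrow> 1) ?F" by simp
  moreover have "\<forall>\<^sub>F x in ?F. 1 + snd x / U (fst x) = (U (fst x) + snd x) / U (fst x)"
    using filterlim_at_infinity_imp_eventually_ne[OF U', of 0]
    by eventually_elim (simp add: field_simps)
  ultimately have "((\<lambda>x. (U (fst x) + snd x) / U (fst x)) \<longlongrightarrow> 1) ?F"
    by (rule Lim_transform_eventually)
  from log_asymp_ratio[OF assms(1) U' this]
  have lim: "((\<lambda>x. b (U (fst x) + snd x) / b (U (fst x))) \<longlongrightarrow> 1) ?F" .
  show ?thesis
  proof (rule uniform_limitI)
    fix e :: real assume "e > 0"
    from tendstoD[OF lim this] obtain P Q where "eventually P sequentially" "\<forall>v\<in>K. Q v"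
      and "\<And>m v. P m \<Longrightarrow> Q v \<Longrightarrow> dist (b (U m + v) / b (U m)) 1 < e"
      unfolding eventually_prod_filter eventually_principal by auto
    then show "\<forall>\<^sub>F m in sequentially. \<forall>v\<in>K. dist (b (U m + v) / b (U m)) 1 < e"
      by (auto elim: eventually_mono)
  qed
qed

section \<open>Zeros of exponential sums with slowly varying coefficients\<close>

lemma uniform_limit_finite_sum:
  fixes f :: "'i \<Rightarrow> 'a \<Rightarrow> 'b \<Rightarrow> 'c::real_normed_vector"
  assumes "\<And>i. i \<in> I \<Longrightarrow> uniform_limit X (f i) (l i) F"
  shows "uniform_limit X (\<lambda>n x. \<Sum>i\<in>I. f i n x) (\<lambda>x. \<Sum>i\<in>I. l i x) F"
  using assms
  by (induction I rule: infinite_finite_induct) (auto intro!: uniform_limit_add uniform_limit_const)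

text \<open>Bolzano-Weierstrass is applied to one index at a time; refining the subsequence
  preserves the limits already obtained.\<close>

lemma finite_family_convergent_subseq:
  fixes d :: "'i \<Rightarrow> nat \<Rightarrow> 'a::heine_borel"
  assumes "finite I" and "\<And>i. i \<in> I \<Longrightarrow> bounded (range (d i))"
  shows "\<exists>r D. strict_mono (r :: nat \<Rightarrow> nat) \<and> (\<forall>i\<in>I. (\<lambda>m. d i (r m)) \<longlonglongrightarrow> D i)"
  using assms
proof (induction I)
  case empty
  show ?case using strict_mono_id by blast
next
  case (insert j I)
  then obtain r D where r: "strict_mono (r :: nat \<Rightarrow> nat)" and D: "\<And>i. i \<in> I \<Longrightarrow> (\<lambda>m. d i (r m)) \<longlonglongrightarrow> D i"
    by auto
  have "bounded (range (d j \<circ> r))"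
    using insert.prems[of j] by (auto intro: bounded_subset)
  from bounded_imp_convergent_subsequence[OF this] obtain l r'
    where r': "strict_mono (r' :: nat \<Rightarrow> nat)" and l: "((d j \<circ> r) \<circ> r') \<longlonglongrightarrow> l" by blast
  have "(\<lambda>m. d i (r (r' m))) \<longlonglongrightarrow> (D(j := l)) i" if "i \<in> insert j I" for i
  proof (cases "i = j")
    case True
    then show ?thesis using l by (simp add: o_def)
  next
    case False
    then have "i \<in> I" using that by simp
    from LIMSEQ_subseq_LIMSEQ[OF D[OF this] r'] False show ?thesis by (simp add: o_def)
  qed
  moreover have "strict_mono (\<lambda>m. r (r' m))"
    using strict_mono_o[OF r r'] by (simp add: o_def)
  ultimately show ?case by blast
qed

text \<open>The intermediate value theorem is applied to \<open>h\<close> for \<open>s\<close> from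
  \<open>-m\<close> to \<open>m\<close>. At the left end the factors \<open>exp (- n m)\<close> push
  the sum below the lower bound of the term with index 0; at the right end a single term with
  \<open>n \<ge> 1\<close> outweighs that term.\<close>

lemma log_asymp_balance:
  fixes b :: "nat \<Rightarrow> complex \<Rightarrow> complex"
  assumes I: "finite I" "0 \<in> I" "I \<noteq> {0}"
    and asymp: "\<And>n. n \<in> I \<Longrightarrow> log_asymp (b n)"
    and diff: "\<And>n. n \<in> I \<Longrightarrow>
      \<forall>\<^sub>F u in at_infinity. u \<notin> \<real>\<^sub>\<le>\<^sub>0 \<longrightarrow> b n field_differentiable at u"
  shows "\<forall>\<^sub>F m in sequentially. \<exists>s. let u = Complex s (2 * pi * real m) in
           norm (b 0 u) = (\<Sum>n\<in>I - {0}. norm (b n u) * exp (real n * s))"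
proof -
  define J where "J = I - {0}"
  define Um where "Um = (\<lambda>t m. Complex (t * real m) (2 * pi * real m))"
  define h where "h = (\<lambda>u. (\<Sum>n\<in>J. norm (b n u) * exp (real n * Re u)) - norm (b 0 u))"
  have "\<forall>\<^sub>F u in at_infinity. \<forall>n\<in>I. u \<notin> \<real>\<^sub>\<le>\<^sub>0 \<longrightarrow> b n field_differentiable at u"
    by (intro eventually_ball_finite ballI I(1) diff)
  then obtain R where R: "\<And>u n. R \<le> norm u \<Longrightarrow> n \<in> I \<Longrightarrow> u \<notin> \<real>\<^sub>\<le>\<^sub>0 \<Longrightarrow> b n field_differentiable at u"
    unfolding eventually_at_infinity by blast
  \<comment> \<open>The imaginary part \<open>2 * pi * m\<close> is positive and at least
    \<open>m\<close>, so the whole line avoids the cut and lies beyond radius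
    \<open>R\<close>.\<close>
  have cont: "continuous_on {- real m..real m} (\<lambda>s. h (Complex s (2 * pi * real m)))"
    if "m > 0" "R \<le> real m" for m
  proof -
    have "continuous_on {- real m..real m} (\<lambda>s. b n (Complex s (2 * pi * real m)))" if n: "n \<in> I" for n
    proof -
      have "b n field_differentiable at u" if "Im u = 2 * pi * real m" for u
      proof (rule R[OF _ n])
        have "real m \<le> 2 * pi * real m" using pi_gt_zero pi_ge_two
          by (simp add: mult_le_cancel_right1 add_increasing)
        also have "\<dots> \<le> norm u" using abs_Im_le_cmod[of u] that by simp
        finally show "R \<le> norm u" using \<open>R \<le> real m\<close> by simp
        show "u \<notin> \<real>\<^sub>\<le>\<^sub>0" using that \<open>m > 0\<close> by (auto simp: complex_nonpos_Reals_iff)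
      qed
      then have "continuous_on {u. Im u = 2 * pi * real m} (b n)"
        by (auto intro!: continuous_at_imp_continuous_on field_differentiable_imp_continuous_at)
      then show ?thesis
        by (rule continuous_on_compose2) (auto intro!: continuous_intros simp: Complex_eq)
    qed
    then show ?thesis unfolding h_def J_def using I by (intro continuous_intros) auto
  qed
  \<comment> \<open>The constant 8 exceeds \<open>1 + 2 * pi\<close>. Hence decay like
    \<open>exp (- m)\<close> is at least as fast as \<open>exp (- norm u / 8)\<close> at both end
    points, and \<open>log_asymp_upper\<close> applies with \<open>1/8\<close>.\<close>
  have Um_norm: "norm (Um t m) \<le> 8 * real m" if "\<bar>t\<bar> = 1" for t m
  proof -
    have "norm (Um t m) \<le> \<bar>t * real m\<bar> + \<bar>2 * pi * real m\<bar>"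
      unfolding Um_def using cmod_le[of "Complex (t * real m) (2 * pi * real m)"] by simp
    also have "\<dots> = (1 + 2 * pi) * real m" using that by (simp add: abs_mult algebra_simps)
    also have "\<dots> \<le> 8 * real m" using pi_less_4 pi_approx by (intro mult_right_mono) auto
    finally show ?thesis .
  qed
  have Um_lim: "filterlim (Um t) at_infinity sequentially" for t
  proof -
    have "filterlim (\<lambda>m. real m) at_top sequentially" by (rule filterlim_real_sequentially)
    moreover have "\<forall>\<^sub>F m in sequentially. real m \<le> norm (Um t m)"
    proof (intro always_eventually allI)
      fix m
      have "real m \<le> 2 * pi * real m" using pi_gt_zero pi_ge_two
        by (simp add: mult_le_cancel_right1 add_increasing)
      also have "\<dots> \<le> norm (Um t m)" using abs_Im_le_cmod[of "Um t m"] by (simp add: Um_def)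
      finally show "real m \<le> norm (Um t m)" .
    qed
    ultimately show ?thesis
      unfolding filterlim_at_infinity_conv_norm_at_top by (rule filterlim_at_top_mono)
  qed
  have decay: "(\<lambda>m. norm (b n (Um t m)) * exp (- (a * real m))) \<longlonglongrightarrow> 0"
    if "n \<in> I" "\<bar>t\<bar> = 1" "a \<ge> 1" for n t a
  proof (rule Lim_null_comparison)
    show "(\<lambda>m. norm (b n (Um t m)) * exp (- (1/8) * norm (Um t m))) \<longlonglongrightarrow> 0"
      by (rule filterlim_compose[OF log_asymp_upper[OF asymp[OF that(1)]] Um_lim]) simp
    show "\<forall>\<^sub>F m in sequentially. norm (norm (b n (Um t m)) * exp (- (a * real m)))
        \<le> norm (b n (Um t m)) * exp (- (1/8) * norm (Um t m))"
    proof (intro always_eventually allI)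
      fix m
      have "1 * real m \<le> a * real m" using that(3) by (intro mult_right_mono) auto
      then have "- (a * real m) \<le> - (1/8) * norm (Um t m)" using Um_norm[OF that(2), of m] by simp
      then show "norm (norm (b n (Um t m)) * exp (- (a * real m)))
        \<le> norm (b n (Um t m)) * exp (- (1/8) * norm (Um t m))"
        by (simp add: mult_left_mono)
    qed
  qed
  have left: "\<forall>\<^sub>F m in sequentially. h (Um (-1) m) \<le> 0"
  proof -
    obtain c where c: "c > 0" "\<forall>\<^sub>F u in at_infinity. c \<le> norm (b 0 u)"
      using log_asymp_lower[OF asymp[OF I(2)]] .
    have "(\<lambda>m. \<Sum>n\<in>J. norm (b n (Um (-1) m)) * exp (- (real n * real m))) \<longlonglongrightarrow> (\<Sum>n\<in>J. 0)"
      by (intro tendsto_sum decay) (auto simp: J_def)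
    then have "\<forall>\<^sub>F m in sequentially. (\<Sum>n\<in>J. norm (b n (Um (-1) m)) * exp (- (real n * real m))) < c"
      using c(1) by (intro order_tendstoD) auto
    with eventually_compose_filterlim[OF c(2) Um_lim[of "-1"]] show ?thesis
      by eventually_elim (simp add: h_def Um_def)
  qed
  have right: "\<forall>\<^sub>F m in sequentially. h (Um 1 m) \<ge> 0"
  proof -
    obtain n where n: "n \<in> J" using I(2,3) unfolding J_def by blast
    then have nI: "n \<in> I" and n1: "n \<ge> 1" by (auto simp: J_def)
    obtain c where c: "c > 0" "\<forall>\<^sub>F u in at_infinity. c \<le> norm (b n u)"
      using log_asymp_lower[OF asymp[OF nI]] .
    have "(\<lambda>m. norm (b 0 (Um 1 m)) * exp (- (real n * real m))) \<longlonglongrightarrow> 0"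
      using n1 I(2) by (intro decay) auto
    then have "\<forall>\<^sub>F m in sequentially. norm (b 0 (Um 1 m)) * exp (- (real n * real m)) < c"
      using c(1) by (intro order_tendstoD) auto
    with eventually_compose_filterlim[OF c(2) Um_lim[of 1]] show ?thesis
    proof eventually_elim
      case (elim m)
      then have "norm (b 0 (Um 1 m)) * exp (- (real n * real m)) \<le> norm (b n (Um 1 m))" by simp
      then have "norm (b 0 (Um 1 m)) \<le> norm (b n (Um 1 m)) * exp (real n * Re (Um 1 m))"
        by (simp add: exp_minus Um_def field_simps)
      also have "\<dots> \<le> (\<Sum>n\<in>J. norm (b n (Um 1 m)) * exp (real n * Re (Um 1 m)))"
        using n I(1) by (intro member_le_sum) (auto simp: J_def)
      finally show ?case by (simp add: h_def)
    qed
  qed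
  have "\<forall>\<^sub>F m in sequentially. m > 0 \<and> R \<le> real m"
    by (intro eventually_conj eventually_gt_at_top eventually_ge_at_top[THEN eventually_compose_filterlim]
        filterlim_real_sequentially)
  with left right show ?thesis
  proof eventually_elim
    case (elim m)
    then obtain s where "h (Complex s (2 * pi * real m)) = 0"
      using IVT'[of "\<lambda>s. h (Complex s (2 * pi * real m))" "- real m" 0 "real m", OF _ _ _ cont]
      by (auto simp: Um_def)
    then show ?case unfolding h_def J_def Let_def by (intro exI[of _ s]) simp
  qed
qed

text \<open>The sum is a polynomial \<open>q\<close> in \<open>exp v\<close>. Its positive degree
  gives a root, and its nonzero constant term keeps the root away from 0, so the root has a
  logarithm. Local nonconstancy is what Hurwitz's theorem will require.\<close>

lemma exp_sum_has_zero:
  fixes D :: "nat \<Rightarrow> complex"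
  assumes I: "finite I" "0 \<in> I" and D: "D 0 \<noteq> 0" "n \<in> I" "n \<noteq> 0" "D n \<noteq> 0"
  obtains v where "(\<Sum>n\<in>I. D n * exp (of_nat n * v)) = 0"
    and "\<And>r. 0 < r \<Longrightarrow> \<not> (\<lambda>v. \<Sum>n\<in>I. D n * exp (of_nat n * v)) constant_on ball v r"
proof -
  define q where "q = (\<Sum>n\<in>I. monom (D n) n)"
  have coeff_q: "poly.coeff q k = (if k \<in> I then D k else 0)" for k
    unfolding q_def using I(1) by (simp add: coeff_sum if_distrib cong: if_cong)
  have poly_q: "poly q (exp v) = (\<Sum>n\<in>I. D n * exp (of_nat n * v))" for v
    unfolding q_def by (simp add: poly_sum poly_monom exp_of_nat_mult)
  have "q \<noteq> 0" using coeff_q[of 0] I D by auto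
  have "degree q > 0" using le_degree[of q n] coeff_q[of n] D by auto
  then obtain w where w: "poly q w = 0"
    using fundamental_theorem_of_algebra[of q] by (auto simp: constant_degree)
  have "w \<noteq> 0"
    using w coeff_q[of 0] D(1) I(2) by (auto simp: poly_0_coeff_0)
  then have zero: "(\<Sum>n\<in>I. D n * exp (of_nat n * Ln w)) = 0"
    using w poly_q[of "Ln w"] by simp
  have "\<not> (\<lambda>v. \<Sum>n\<in>I. D n * exp (of_nat n * v)) constant_on ball (Ln w) r" if "0 < r" for r
  proof
    assume const: "(\<lambda>v. \<Sum>n\<in>I. D n * exp (of_nat n * v)) constant_on ball (Ln w) r"
    \<comment> \<open>The constant would be the value 0 at the centre, so \<open>exp\<close> would
      map the ball into the finite root set of \<open>q\<close>, although its image is open.\<close>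
    have "exp ` ball (Ln w) r \<subseteq> {x. poly q x = 0}"
      using const zero that unfolding constant_on_def poly_q[symmetric]
      by (metis (mono_tags, lifting) centre_in_ball image_subsetI mem_Collect_eq)
    then have "finite (exp ` ball (Ln w) r)"
      using poly_roots_finite[OF \<open>q \<noteq> 0\<close>] finite_subset by blast
    moreover have "open (exp ` ball (Ln w) r)"
    proof (rule open_mapping_thm[of exp UNIV])
      have "exp (0::complex) \<noteq> exp 1"
        using norm_exp_eq_Re[of 1] by (metis exp_zero norm_one one_complex.sel(1) exp_eq_one_iff zero_neq_one)
      then show "\<not> (exp :: complex \<Rightarrow> complex) constant_on UNIV"
        unfolding constant_on_def by (metis UNIV_I)
    qed (auto intro!: holomorphic_intros)
    ultimately show False
      using that open_ball finite_imp_not_open[of "exp ` ball (Ln w) r"] by auto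
  qed
  with zero that show thesis by blast
qed

lemma log_asymp_exp_poly_zero:
  fixes b :: "nat \<Rightarrow> complex \<Rightarrow> complex"
  assumes I: "finite I" "0 \<in> I" "I \<noteq> {0}"
    and asymp: "\<And>n. n \<in> I \<Longrightarrow> log_asymp (b n)"
    and diff: "\<And>n. n \<in> I \<Longrightarrow>
      \<forall>\<^sub>F u in at_infinity. u \<notin> \<real>\<^sub>\<le>\<^sub>0 \<longrightarrow> b n field_differentiable at u"
  shows "\<exists>\<^sub>F u in at_infinity. (\<Sum>n\<in>I. b n u * exp (of_nat n * u)) = 0"
proof (rule ccontr)
  assume "\<not> ?thesis"
  then have nz: "\<forall>\<^sub>F u in at_infinity. (\<Sum>n\<in>I. b n u * exp (of_nat n * u)) \<noteq> 0"
    by (simp add: not_frequently)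
  obtain s where s: "\<forall>\<^sub>F m in sequentially. let u = Complex (s m) (2 * pi * real m) in
      norm (b 0 u) = (\<Sum>n\<in>I - {0}. norm (b n u) * exp (real n * s m))"
    using log_asymp_balance[of I b, OF I asymp diff] unfolding eventually_ex by blast
  define U where "U = (\<lambda>m. Complex (s m) (2 * pi * real m))"
  define J where "J = I - {0}"
  have ImU: "real m \<le> Im (U m)" for m
    using pi_ge_two pi_gt_zero by (simp add: U_def mult_le_cancel_right1 add_increasing)
  have Ulim: "filterlim U at_infinity sequentially"
  proof -
    have "\<forall>\<^sub>F m in sequentially. real m \<le> norm (U m)"
      using ImU abs_Im_le_cmod by (intro always_eventually allI) (meson abs_ge_self order_trans)
    then show ?thesis
      using filterlim_at_top_mono[OF filterlim_real_sequentially]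
      by (simp add: filterlim_at_infinity_conv_norm_at_top)
  qed
  have bnz: "\<forall>\<^sub>F u in at_infinity. \<forall>n\<in>I. b n u \<noteq> 0"
  proof (rule eventually_ball_finite[OF I(1)], rule ballI)
    fix n assume "n \<in> I"
    then obtain c where "c > 0" "\<forall>\<^sub>F u in at_infinity. c \<le> norm (b n u)"
      using log_asymp_lower[OF asymp] by blast
    then show "\<forall>\<^sub>F u in at_infinity. b n u \<noteq> 0" by (auto elim: eventually_mono)
  qed
  \<comment> \<open>These are the coefficients of the sum translated by \<open>U m\<close> and
    divided by \<open>b 0 (U m)\<close>. Thus \<open>d 0 m = 1\<close>, and the balance makes the
    other moduli add up to 1 for large \<open>m\<close>.\<close>
  define d where "d = (\<lambda>n m. b n (U m) * exp (of_nat n * U m) / b 0 (U m))"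
  have "\<forall>\<^sub>F m in sequentially. (\<forall>n\<in>I. b n (U m) \<noteq> 0) \<and> (\<Sum>n\<in>J. norm (d n m)) = 1"
    using eventually_compose_filterlim[OF bnz Ulim] s
  proof eventually_elim
    case (elim m)
    have "(\<Sum>n\<in>J. norm (d n m)) = (\<Sum>n\<in>J. norm (b n (U m)) * exp (real n * s m)) / norm (b 0 (U m))"
      by (simp add: d_def norm_divide norm_mult sum_divide_distrib U_def)
    also have "\<dots> = norm (b 0 (U m)) / norm (b 0 (U m))"
      using elim(2) by (simp add: U_def J_def Let_def)
    also have "\<dots> = 1" using elim(1) I(2) by simp
    finally show ?case using elim by simp
  qed
  then obtain M where M: "\<And>m. m \<ge> M \<Longrightarrow> (\<forall>n\<in>I. b n (U m) \<noteq> 0) \<and> (\<Sum>n\<in>J. norm (d n m)) = 1"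
    unfolding eventually_sequentially by blast
  have d0: "d 0 m = 1" if "m \<ge> M" for m using M[OF that] I(2) by (simp add: d_def)
  have dle: "norm (d n m) \<le> 1" if "n \<in> I" "m \<ge> M" for n m
  proof (cases "n = 0")
    case False
    then have "norm (d n m) \<le> (\<Sum>n\<in>J. norm (d n m))"
      using that I(1) by (intro member_le_sum) (auto simp: J_def)
    then show ?thesis using M[OF that(2)] by simp
  qed (simp add: d0 that)
  have "bounded (range (\<lambda>m. d n (m + M)))" if "n \<in> I" for n
    using dle[OF that] by (intro boundedI[where B=1]) auto
  from finite_family_convergent_subseq[of I "\<lambda>n m. d n (m + M)", OF I(1) this] obtain r0 D
    where r0: "strict_mono (r0 :: nat \<Rightarrow> nat)" and "\<And>n. n \<in> I \<Longrightarrow> (\<lambda>m. d n (r0 m + M)) \<longlonglongrightarrow> D n"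
    by blast
  moreover define r where "r = (\<lambda>m. r0 m + M)"
  ultimately have D: "\<And>n. n \<in> I \<Longrightarrow> (\<lambda>m. d n (r m)) \<longlonglongrightarrow> D n" by simp
  have r: "strict_mono r" using r0 by (simp add: r_def strict_mono_def)
  have rM: "r m \<ge> M" for m by (simp add: r_def)
  have "(\<lambda>m. d 0 (r m)) \<longlonglongrightarrow> 1" using d0[OF rM] by simp
  then have D0: "D 0 = 1" using D[OF I(2)] LIMSEQ_unique by blast
  \<comment> \<open>The balance survives in the limit, so some coefficient of positive index is
    nonzero and the limit is not a monomial in \<open>exp v\<close>.\<close>
  have "(\<lambda>m. \<Sum>n\<in>J. norm (d n (r m))) \<longlonglongrightarrow> (\<Sum>n\<in>J. norm (D n))"
    by (intro tendsto_intros D) (auto simp: J_def)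
  then have "(\<Sum>n\<in>J. norm (D n)) = 1" using M[OF rM] by (simp add: LIMSEQ_const_iff)
  then have "\<exists>n\<in>J. D n \<noteq> 0" by (metis norm_zero sum.neutral zero_neq_one)
  then obtain n1 where n1: "n1 \<in> I" "n1 \<noteq> 0" "D n1 \<noteq> 0" by (auto simp: J_def)
  define g where "g = (\<lambda>v. \<Sum>n\<in>I. D n * exp (of_nat n * v))"
  obtain v0 where v0: "g v0 = 0" and nonconst: "\<And>r. 0 < r \<Longrightarrow> \<not> g constant_on ball v0 r"
    unfolding g_def by (rule exp_sum_has_zero[where D = D, OF I(1,2) _ n1]) (use D0 in auto)
  define S where "S = ball v0 1"
  define G where "G = (\<lambda>m v. (\<Sum>n\<in>I. b n (U m + v) * exp (of_nat n * (U m + v))) / b 0 (U m))"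
  have "\<forall>\<^sub>F u in at_infinity. (\<Sum>n\<in>I. b n u * exp (of_nat n * u)) \<noteq> 0 \<and>
      (\<forall>n\<in>I. u \<notin> \<real>\<^sub>\<le>\<^sub>0 \<longrightarrow> b n field_differentiable at u)"
    by (intro eventually_conj eventually_ball_finite ballI nz I(1) diff)
  then obtain R where R: "\<And>u. R \<le> norm u \<Longrightarrow> (\<Sum>n\<in>I. b n u * exp (of_nat n * u)) \<noteq> 0"
      "\<And>u n. R \<le> norm u \<Longrightarrow> n \<in> I \<Longrightarrow> u \<notin> \<real>\<^sub>\<le>\<^sub>0 \<Longrightarrow> b n field_differentiable at u"
    unfolding eventually_at_infinity by blast
  \<comment> \<open>For \<open>m \<ge> N\<close> the imaginary part of \<open>U m + v\<close>
    exceeds \<open>max R 0\<close> on all of \<open>S\<close>, so these points are beyond radius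
    \<open>R\<close> and off the cut.\<close>
  obtain N where N: "real N > norm v0 + 1 + max R 0" using reals_Archimedean2 by blast
  have far: "R \<le> norm (U m + v) \<and> U m + v \<notin> \<real>\<^sub>\<le>\<^sub>0" if "m \<ge> N" "v \<in> S" for m v
  proof -
    have "norm v < norm v0 + 1"
      using that(2) norm_triangle_ineq4[of v0 "v0 - v"] by (simp add: S_def dist_norm)
    then have "Im (U m + v) > max R 0"
      using ImU[of m] abs_Im_le_cmod[of v] that(1) N by simp linarith
    then show ?thesis
      using abs_Im_le_cmod[of "U m + v"] by (auto simp: complex_nonpos_Reals_iff)
  qed
  have "g v0 \<noteq> 0"
  \<comment> \<open>The functions \<open>G (r (m + N))\<close> are holomorphic and zero-free on
    \<open>S\<close>, so their nonconstant limit \<open>g\<close> would be zero-free there, contrary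
    to \<open>g v0 = 0\<close>.\<close>
  proof (rule Hurwitz_no_zeros[where S = S and g = g and ?z0.0 = v0 and \<F> = "\<lambda>m. G (r (m + N))"])
    have rN: "r (m + N) \<ge> N" for m
      using strict_mono_imp_increasing[OF r, of "m + N"] by simp
    show "open S" "connected S" "v0 \<in> S" by (auto simp: S_def)
    show "g holomorphic_on S" unfolding g_def by (intro holomorphic_intros)
    show "\<not> g constant_on S" unfolding S_def by (rule nonconst) simp
    show "G (r (m + N)) v \<noteq> 0" if "v \<in> S" for m v
      using R(1) far[OF rN that] M[OF rM] I(2) by (simp add: G_def)
    show "G (r (m + N)) holomorphic_on S" for m
    proof -
      have "(\<lambda>v. b n (U (r (m + N)) + v)) holomorphic_on S" if "n \<in> I" for n
      proof -
        have "(\<lambda>v. b n (U (r (m + N)) + v)) field_differentiable at v" if "v \<in> S" for v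
        proof -
          have "b n field_differentiable at (U (r (m + N)) + v)"
            using R(2) far[OF rN that] \<open>n \<in> I\<close> by blast
          then have "(b n \<circ> (\<lambda>v. U (r (m + N)) + v)) field_differentiable at v"
            by (intro field_differentiable_compose field_differentiable_add
                field_differentiable_const field_differentiable_ident)
          then show ?thesis by (simp add: o_def)
        qed
        then show ?thesis
          by (auto simp: holomorphic_on_def intro: field_differentiable_at_within)
      qed
      then show ?thesis unfolding G_def using M[OF rM] I(2) by (intro holomorphic_intros) auto
    qed
    fix K assume K: "compact K" "K \<subseteq> S"
    have rN_lim: "filterlim (\<lambda>m. r (m + N)) sequentially sequentially"
      using filterlim_compose[OF filterlim_subseq[OF r] filterlim_add_const_nat_at_top[of N]] .
    \<comment> \<open>Each term of \<open>G\<close> splits into a slowly varying quotient tending to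
      1 uniformly, a convergent coefficient \<open>d\<close>, and a fixed exponential bounded on
      \<open>K\<close>.\<close>
    have "uniform_limit K
        (\<lambda>m v. \<Sum>n\<in>I. (b n (U (r (m + N)) + v) / b n (U (r (m + N)))) * (d n (r (m + N)) * exp (of_nat n * v)))
        (\<lambda>v. \<Sum>n\<in>I. 1 * (D n * exp (of_nat n * v))) sequentially"
    proof (intro uniform_limit_finite_sum uniform_lim_mult uniform_limit_const)
      fix n assume n: "n \<in> I"
      show "uniform_limit K (\<lambda>m v. b n (U (r (m + N)) + v) / b n (U (r (m + N)))) (\<lambda>v. 1) sequentially"
        by (rule log_asymp_uniform_ratio[OF asymp[OF n] filterlim_compose[OF Ulim rN_lim] compact_imp_bounded[OF K(1)]])
      have "(\<lambda>m. d n (r (m + N))) \<longlonglongrightarrow> D n"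
        using LIMSEQ_ignore_initial_segment[OF D[OF n], of N] .
      then show "uniform_limit K (\<lambda>m v. d n (r (m + N))) (\<lambda>v. D n) sequentially"
        by (auto simp: uniform_limit_iff tendsto_iff elim: eventually_mono)
      show "bounded ((\<lambda>v. D n) ` K)" "bounded ((\<lambda>v. 1::complex) ` K)"
        by (auto simp: bounded_iff)
      show "bounded ((\<lambda>v. exp (of_nat n * v)) ` K)"
        by (intro compact_imp_bounded compact_continuous_image continuous_intros K)
      show "bounded ((\<lambda>v. D n * exp (of_nat n * v)) ` K)"
        by (intro compact_imp_bounded compact_continuous_image continuous_intros K)
    qed
    moreover have "(\<Sum>n\<in>I. (b n (U (r (m + N)) + v) / b n (U (r (m + N)))) * (d n (r (m + N)) * exp (of_nat n * v)))
        = G (r (m + N)) v" for m v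
      unfolding G_def sum_divide_distrib
      using M[OF rM] I(2) by (intro sum.cong) (auto simp: d_def distrib_left exp_add)
    ultimately show "uniform_limit K (\<lambda>m. G (r (m + N))) g sequentially"
      by (simp add: g_def)
  qed
  with v0 show False by simp
qed

section \<open>From iterated exponentials to iterated logarithms\<close>

lemma log_monomial_conv_prod:
  "log_monomial as u = (\<Prod>j<length as. (Ln ^^ j) u ^ (as ! j))"
proof (induction as arbitrary: u)
  case (Cons a as)
  show ?case
    unfolding length_Cons prod.lessThan_Suc_shift
    by (simp add: Cons funpow_swap1)
qed simp

text \<open>\<open>exp (Ln w) = w\<close> for every \<open>w \<noteq> 0\<close>, and for large
  \<open>u\<close> the intermediate logarithms are nonzero since they tend to infinity too.\<close>

lemma iter_exp_funpow_Ln: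
  "\<forall>\<^sub>F u in at_infinity. \<forall>i\<le>n. iter_exp i ((Ln ^^ n) u) = (Ln ^^ (n - i)) u"
proof (induction n)
  case (Suc n)
  have "\<forall>\<^sub>F u in at_infinity. \<forall>i\<le>n. iter_exp i ((Ln ^^ n) (Ln u)) = (Ln ^^ (n - i)) (Ln u)"
    by (rule eventually_compose_filterlim[OF Suc filterlim_Ln_at_infinity])
  with eventually_not_equal_at_infinity[of "0::complex"] show ?case
  proof eventually_elim
    case (elim u)
    have *: "(Ln ^^ Suc n) u = (Ln ^^ n) (Ln u)" by (simp add: funpow_swap1)
    show ?case
    proof (intro allI impI)
      fix i assume "i \<le> Suc n"
      show "iter_exp i ((Ln ^^ Suc n) u) = (Ln ^^ (Suc n - i)) u"
      proof (cases "i = Suc n")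
        case True
        have "iter_exp n ((Ln ^^ n) (Ln u)) = Ln u" using elim by simp
        then show ?thesis using elim(1) True unfolding * by simp
      next
        case False
        then have "i \<le> n" using \<open>i \<le> Suc n\<close> by simp
        then show ?thesis
          using elim(2) unfolding * by (simp add: Suc_diff_le funpow_swap1)
      qed
    qed
  qed
qed simp

text \<open>The list is reversed because position \<open>j\<close> belongs to the
  \<open>j\<close>-fold logarithm of \<open>u\<close>, which is the iterated exponential of index
  \<open>l - j\<close>. The bound on \<open>u\<close> is uniform in \<open>e\<close>, so one
  \<open>u\<close> serves all monomials at once.\<close>

lemma log_monomial_eq_prod_iter_exp:
  "\<forall>\<^sub>F u in at_infinity. \<forall>e. log_monomial (map (\<lambda>j. e (l - j)) [0..<Suc l]) u =
     (\<Prod>i\<le>l. iter_exp i ((Ln ^^ l) u) ^ e i)"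
  using iter_exp_funpow_Ln[of l]
proof eventually_elim
  case (elim u)
  show ?case
  proof
    fix e :: "nat \<Rightarrow> nat"
    have "log_monomial (map (\<lambda>j. e (l - j)) [0..<Suc l]) u = (\<Prod>j<Suc l. (Ln ^^ j) u ^ e (l - j))"
      unfolding log_monomial_conv_prod by (intro prod.cong) (auto simp del: upt_Suc)
    also have "\<dots> = (\<Prod>i<Suc l. (Ln ^^ (l - i)) u ^ e i)"
      by (subst prod.nat_diff_reindex[symmetric]) (auto intro!: prod.cong)
    also have "\<dots> = (\<Prod>i\<le>l. iter_exp i ((Ln ^^ l) u) ^ e i)"
      using elim by (intro prod.cong) auto
    finally show "log_monomial (map (\<lambda>j. e (l - j)) [0..<Suc l]) u =
      (\<Prod>i\<le>l. iter_exp i ((Ln ^^ l) u) ^ e i)" .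
  qed
qed

lemma eventually_log_sum_differentiable:
  assumes "finite S"
  shows "\<forall>\<^sub>F u in at_infinity. u \<notin> \<real>\<^sub>\<le>\<^sub>0 \<longrightarrow>
    (\<lambda>u. \<Sum>s\<in>S. c s * log_monomial (e s) u) field_differentiable at u"
proof -
  have "\<forall>\<^sub>F u in at_infinity. \<forall>s\<in>S. u \<notin> \<real>\<^sub>\<le>\<^sub>0 \<longrightarrow> log_monomial (e s) field_differentiable at u"
    by (intro eventually_ball_finite ballI assms eventually_log_monomial_differentiable)
  then show ?thesis
    by eventually_elim
      (auto intro!: field_differentiable_sum field_differentiable_mult field_differentiable_const)
qed

text \<open>With \<open>u = iter_exp l z\<close> the top exponential is \<open>exp u\<close>, and
  grouping the terms by its exponent gives an exponential sum whose coefficients are sums of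
  logarithmic monomials.\<close>

lemma infinite_zeros_of_nonconstant_top_exponent:
  fixes S :: "'m set" and c :: "'m \<Rightarrow> complex" and e :: "'m \<Rightarrow> nat \<Rightarrow> nat"
  assumes S: "finite S" and c: "\<And>m. m \<in> S \<Longrightarrow> c m \<noteq> 0"
    and inj: "\<And>m m'. m \<in> S \<Longrightarrow> m' \<in> S \<Longrightarrow> (\<And>i. i \<le> Suc l \<Longrightarrow> e m i = e m' i) \<Longrightarrow> m = m'"
    and nonconst: "m1 \<in> S" "m2 \<in> S" "e m1 (Suc l) \<noteq> e m2 (Suc l)"
  shows "infinite {z. (\<Sum>m\<in>S. c m * (\<Prod>i\<le>Suc l. iter_exp i z ^ e m i)) = 0}"
proof
  assume fin: "finite {z. (\<Sum>m\<in>S. c m * (\<Prod>i\<le>Suc l. iter_exp i z ^ e m i)) = 0}"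
    (is "finite ?Z")
  \<comment> \<open>Dividing out the zero-free factor \<open>exp (n0 u)\<close> makes index 0 occur
    among the degrees.\<close>
  define n0 where "n0 = Min ((\<lambda>m. e m (Suc l)) ` S)"
  have n0_le: "n0 \<le> e m (Suc l)" if "m \<in> S" for m
    unfolding n0_def using S that by simp
  have "n0 \<in> (\<lambda>m. e m (Suc l)) ` S"
    unfolding n0_def using S nonconst by (intro Min_in) auto
  then obtain m0 where m0: "m0 \<in> S" "e m0 (Suc l) = n0" by auto
  define deg where "deg = (\<lambda>m. e m (Suc l) - n0)"
  define logs where "logs = (\<lambda>m. map (\<lambda>j. e m (l - j)) [0..<Suc l])"
  define b where "b = (\<lambda>n u. \<Sum>m\<in>{m \<in> S. deg m = n}. c m * log_monomial (logs m) u)"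
  have freq: "\<exists>\<^sub>F u in at_infinity. (\<Sum>n\<in>deg ` S. b n u * exp (of_nat n * u)) = 0"
  proof (rule log_asymp_exp_poly_zero)
    show "finite (deg ` S)" using S by simp
    show "0 \<in> deg ` S" using m0 by (force simp: deg_def)
    have "deg m1 \<noteq> deg m2" using nonconst n0_le by (simp add: deg_def eq_diff_iff)
    then show "deg ` S \<noteq> {0}" using nonconst(1,2) by (metis image_eqI singletonD)
    show "\<forall>\<^sub>F u in at_infinity. u \<notin> \<real>\<^sub>\<le>\<^sub>0 \<longrightarrow> b n field_differentiable at u" for n
      unfolding b_def using S by (intro eventually_log_sum_differentiable) auto
    show "log_asymp (b n)" if "n \<in> deg ` S" for n
      unfolding b_def
    proof (rule log_asymp_sum)
      \<comment> \<open>Within one degree the top exponent is fixed and \<open>logs\<close> records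
        all lower ones, so \<open>inj\<close> identifies the terms.\<close>
      show "inj_on logs {m \<in> S. deg m = n}"
      proof (rule inj_onI)
        fix m m' assume m: "m \<in> {m \<in> S. deg m = n}" "m' \<in> {m \<in> S. deg m = n}" "logs m = logs m'"
        have "e m i = e m' i" if "i \<le> Suc l" for i
        proof (cases "i = Suc l")
          case True
          then show ?thesis using m(1,2) n0_le[of m] n0_le[of m'] by (auto simp: deg_def)
        next
          case False
          then have "logs m ! (l - i) = logs m' ! (l - i)" "i \<le> l" using m(3) that by auto
          then show ?thesis
            using nth_upt[of 0 "l - i" "Suc l"] by (simp add: logs_def del: upt_Suc)
        qed
        then show "m = m'" using inj m(1,2) by blast
      qed
      show "length (logs m) = Suc l" for m by (simp add: logs_def)
    qed (use S c that in auto)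
  qed
  \<comment> \<open>A zero \<open>u\<close> of the exponential sum with \<open>norm u > B\<close>
    yields a zero \<open>z\<close> with \<open>iter_exp l z = u\<close>, which contradicts the bound
    \<open>B\<close>.\<close>
  have "bounded (iter_exp l ` ?Z)" using fin by (intro finite_imp_bounded finite_imageI)
  then obtain B where B: "\<And>z. z \<in> ?Z \<Longrightarrow> norm (iter_exp l z) \<le> B"
    by (auto simp: bounded_iff)
  note ev = eventually_conj[OF eventually_norm_gt_at_infinity[of B]
      eventually_conj[OF iter_exp_funpow_Ln[of l] log_monomial_eq_prod_iter_exp[of l]]]
  from frequently_ex[OF frequently_eventually_conj[OF freq ev]] obtain u where zero: "(\<Sum>n\<in>deg ` S. b n u * exp (of_nat n * u)) = 0"
    and "B < norm u" and it: "\<forall>i\<le>l. iter_exp i ((Ln ^^ l) u) = (Ln ^^ (l - i)) u"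
    and prod: "\<And>e. log_monomial (map (\<lambda>j. e (l - j)) [0..<Suc l]) u =
        (\<Prod>i\<le>l. iter_exp i ((Ln ^^ l) u) ^ e i)"
    by blast
  define z where "z = (Ln ^^ l) u"
  have u: "iter_exp l z = u" using it by (simp add: z_def)
  have "(\<Sum>m\<in>S. c m * (\<Prod>i\<le>Suc l. iter_exp i z ^ e m i)) =
      (\<Sum>m\<in>S. exp (of_nat n0 * u) * (c m * log_monomial (logs m) u * exp (of_nat (deg m) * u)))"
  proof (rule sum.cong[OF refl])
    fix m assume "m \<in> S"
    have "exp u ^ e m (Suc l) = exp (of_nat n0 * u) * exp (of_nat (deg m) * u)"
      using n0_le[OF \<open>m \<in> S\<close>] unfolding deg_def exp_of_nat_mult
      by (simp flip: power_add)
    then show "c m * (\<Prod>i\<le>Suc l. iter_exp i z ^ e m i) =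
        exp (of_nat n0 * u) * (c m * log_monomial (logs m) u * exp (of_nat (deg m) * u))"
      using prod[of "e m"] u by (simp add: logs_def z_def del: upt_Suc)
  qed
  also have "\<dots> = exp (of_nat n0 * u) * (\<Sum>m\<in>S. c m * log_monomial (logs m) u * exp (of_nat (deg m) * u))"
    by (simp add: sum_distrib_left)
  also have "(\<Sum>m\<in>S. c m * log_monomial (logs m) u * exp (of_nat (deg m) * u)) =
      (\<Sum>n\<in>deg ` S. b n u * exp (of_nat n * u))"
    unfolding b_def by (subst sum.image_gen[OF S, of _ deg]) (simp add: sum_distrib_right)
  finally have "z \<in> ?Z" using zero by simp
  then show False using B[of z] u \<open>B < norm u\<close> by simp
qed

section \<open>Polynomials whose monomials share their exponents\<close>

lemma eval_cmpoly_polys_in: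
  assumes "p \<in> polys_in {0..k}"
  shows "eval_cmpoly a p = (\<Sum>m\<in>Poly_Mapping.keys p. Poly_Mapping.lookup p m *
    (\<Prod>i\<le>k. a i ^ Poly_Mapping.lookup m i))"
  unfolding eval_cmpoly_def
proof (intro sum.cong refl arg_cong2[where f="(*)"] prod.mono_neutral_left)
  fix m assume "m \<in> Poly_Mapping.keys p"
  then show "Poly_Mapping.keys m \<subseteq> {..k}" using assms by (fastforce simp: polys_in_def)
qed (auto simp: in_keys_iff)

lemma var_power: "var i ^ n = Poly_Mapping.single (Poly_Mapping.single i n) 1"
  by (induction n) (simp_all add: var_def mult_single flip: single_add)

lemma prod_var_power:
  "finite A \<Longrightarrow> (\<Prod>j\<in>A. var j ^ n j) = Poly_Mapping.single (\<Sum>j\<in>A. Poly_Mapping.single j (n j)) 1"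
  by (induction A rule: finite_induct) (simp_all add: var_power mult_single)

lemma poly_mapping_sum_single:
  "(\<Sum>m\<in>Poly_Mapping.keys p. Poly_Mapping.single m (Poly_Mapping.lookup p m)) = p"
  by (rule poly_mapping_eqI) (auto simp: lookup_sum lookup_single when_def in_keys_iff)

text \<open>The factor \<open>g\<close> keeps only the power of variable 0 from each monomial; the
  common remaining part multiplies back to \<open>p\<close>.\<close>

lemma factor_constant_exponents:
  assumes p: "p \<in> polys_in {0..k}"
    and const: "\<And>m j. m \<in> Poly_Mapping.keys p \<Longrightarrow> j \<in> {1..k} \<Longrightarrow> Poly_Mapping.lookup m j = n j"
  shows "\<exists>g\<in>polys_in {0}. p = g * (\<Prod>j = 1..k. var j ^ n j)"
proof
  define g where "g = (\<Sum>m\<in>Poly_Mapping.keys p.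
    Poly_Mapping.single (Poly_Mapping.single 0 (Poly_Mapping.lookup m 0)) (Poly_Mapping.lookup p m) :: cmpoly)"
  show "g \<in> polys_in {0}"
    unfolding polys_in_def g_def
  proof (intro CollectI ballI)
    fix m' assume "m' \<in> Poly_Mapping.keys (\<Sum>m\<in>Poly_Mapping.keys p.
      Poly_Mapping.single (Poly_Mapping.single 0 (Poly_Mapping.lookup m 0)) (Poly_Mapping.lookup p m) :: cmpoly)"
    from subsetD[OF keys_sum this] obtain a where "m' = Poly_Mapping.single (0::nat) (a::nat)"
      by (auto split: if_splits)
    then show "Poly_Mapping.keys m' \<subseteq> {0}" by simp
  qed
  have mono: "Poly_Mapping.single 0 (Poly_Mapping.lookup m 0) + (\<Sum>j = 1..k. Poly_Mapping.single j (n j)) = m"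
    if m: "m \<in> Poly_Mapping.keys p" for m
  proof (rule poly_mapping_eqI)
    fix i
    have "i \<notin> Poly_Mapping.keys m" if "i > k" using p m that by (fastforce simp: polys_in_def)
    then have "Poly_Mapping.lookup m i = 0" if "i > k" using that by (simp add: in_keys_iff)
    then show "Poly_Mapping.lookup (Poly_Mapping.single 0 (Poly_Mapping.lookup m 0) +
        (\<Sum>j = 1..k. Poly_Mapping.single j (n j))) i = Poly_Mapping.lookup m i"
      using const[OF m, of i]
      by (cases "i = 0"; cases "i \<le> k") (auto simp: lookup_add lookup_sum lookup_single when_def)
  qed
  have "g * (\<Prod>j = 1..k. var j ^ n j) =
      (\<Sum>m\<in>Poly_Mapping.keys p. Poly_Mapping.single m (Poly_Mapping.lookup p m))"
    unfolding g_def by (simp add: prod_var_power sum_distrib_right mult_single mono[simplified])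
  then show "p = g * (\<Prod>j = 1..k. var j ^ n j)" by (simp add: poly_mapping_sum_single)
qed

section \<open>Reduction to the last varying exponent\<close>

theorem theorem3p4:
  fixes k :: nat and p :: cmpoly and f :: "complex \<Rightarrow> complex"
  assumes k: "k \<ge> 1"
    and irr: "irreducible_in {0..k} p"
    and f: "\<And>z. f z = eval_cmpoly (\<lambda>j. iter_exp j z) p"
    and not_exceptional:
      "\<not> (\<exists>g \<in> polys_in {0}. \<exists>n :: nat \<Rightarrow> nat. p = g * (\<Prod>j = 1..k. var j ^ n j))"
  shows "infinite {z. f z = 0}"
proof -
  define S where "S = Poly_Mapping.keys p"
  define c where "c = Poly_Mapping.lookup p"
  define e where "e = (\<lambda>m::nat \<Rightarrow>\<^sub>0 nat. Poly_Mapping.lookup m)"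
  have p: "p \<in> polys_in {0..k}" using irr by (simp add: irreducible_in_def)
  define varies where "varies = (\<lambda>j. j \<in> {1..k} \<and> (\<exists>m\<in>S. \<exists>m'\<in>S. e m j \<noteq> e m' j))"
  have "\<exists>j. varies j"
  proof (rule ccontr)
    assume *: "\<not> ?thesis"
    \<comment> \<open>If no exponent varies, any chosen monomial provides the common exponents, and
      \<open>p\<close> has the excluded form.\<close>
    have "e m j = e (SOME m. m \<in> S) j" if "m \<in> S" "j \<in> {1..k}" for m j
    proof -
      have "(SOME m. m \<in> S) \<in> S" using that(1) by (rule someI)
      then show ?thesis using * that unfolding varies_def by blast
    qed
    then have "\<exists>g\<in>polys_in {0}. p = g * (\<Prod>j = 1..k. var j ^ e (SOME m. m \<in> S) j)"
      unfolding S_def e_def by (intro factor_constant_exponents[OF p]) blast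
    then show False using not_exceptional by blast
  qed
  moreover have "j \<le> k" if "varies j" for j using that by (simp add: varies_def)
  ultimately have "varies (Greatest varies)" and "\<And>j. varies j \<Longrightarrow> j \<le> Greatest varies"
    using GreatestI_nat Greatest_le_nat by blast+
  \<comment> \<open>A varying index is at least 1, so the largest one is a successor; variable 0
    never counts as varying.\<close>
  then obtain l where l: "varies (Suc l)" and max: "\<And>j. varies j \<Longrightarrow> j \<le> Suc l"
    by (cases "Greatest varies") (auto simp: varies_def)
  obtain m1 m2 where m12: "m1 \<in> S" "m2 \<in> S" "e m1 (Suc l) \<noteq> e m2 (Suc l)" and lk: "Suc l \<le> k"
    using l by (auto simp: varies_def)
  have above: "e m j = e m1 j" if "m \<in> S" "j > Suc l" "j \<le> k" for m j
    using max[of j] that m12 by (auto simp: varies_def)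
  have "infinite {z. (\<Sum>m\<in>S. c m * (\<Prod>i\<le>Suc l. iter_exp i z ^ e m i)) = 0}"
  proof (rule infinite_zeros_of_nonconstant_top_exponent[where e = e, OF _ _ _ m12])
    fix m m' assume m: "m \<in> S" "m' \<in> S" and low: "\<And>i. i \<le> Suc l \<Longrightarrow> e m i = e m' i"
    \<comment> \<open>Exponents between \<open>Suc l\<close> and \<open>k\<close> are common to all
      monomials and those beyond \<open>k\<close> vanish, so the exponents up to
      \<open>Suc l\<close> determine the monomial.\<close>
    have "e m i = e m' i" for i
    proof -
      consider "i \<le> Suc l" | "i > Suc l" "i \<le> k" | "i > k" by linarith
      then show ?thesis
      proof cases
        case 3
        then have "i \<notin> Poly_Mapping.keys m" "i \<notin> Poly_Mapping.keys m'"
          using p m by (fastforce simp: polys_in_def S_def)+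
        then show ?thesis by (simp add: e_def in_keys_iff)
      qed (use low above m in auto)
    qed
    then show "m = m'" by (simp add: e_def poly_mapping_eqI)
  qed (auto simp: S_def c_def in_keys_iff)
  also have "{z. (\<Sum>m\<in>S. c m * (\<Prod>i\<le>Suc l. iter_exp i z ^ e m i)) = 0} = {z. f z = 0}"
  proof -
    \<comment> \<open>The common powers of the later exponentials come out as a factor, which has no
      zeros because each of them is a value of \<open>exp\<close>.\<close>
    have "f z = (\<Prod>i\<in>{Suc l<..k}. iter_exp i z ^ e m1 i) *
        (\<Sum>m\<in>S. c m * (\<Prod>i\<le>Suc l. iter_exp i z ^ e m i))" for z
    proof -
      have split: "{..k} = {..Suc l} \<union> {Suc l<..k}" using lk by auto
      have "(\<Prod>i\<le>k. iter_exp i z ^ e m i) =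
          (\<Prod>i\<le>Suc l. iter_exp i z ^ e m i) * (\<Prod>i\<in>{Suc l<..k}. iter_exp i z ^ e m1 i)"
        if "m \<in> S" for m
        unfolding split using above[OF that]
        by (subst prod.union_disjoint) (auto intro!: arg_cong2[where f="(*)"] prod.cong)
      then show ?thesis
        unfolding f eval_cmpoly_polys_in[OF p] sum_distrib_left
        by (intro sum.cong) (auto simp: S_def c_def e_def)
    qed
    moreover have "(\<Prod>i\<in>{Suc l<..k}. iter_exp i z ^ e m1 i) \<noteq> 0" for z
    proof -
      have "iter_exp i z \<noteq> 0" if "i > Suc l" for i using that by (cases i) auto
      then show ?thesis by (simp add: prod_zero_iff)
    qed
    ultimately show ?thesis by (simp only: mult_eq_0_iff simp_thms)
  qed
  finally show ?thesis .
qed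

end
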